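(* Let $q\in\mathbb C^*$ with $q^2\neq1$, let $\Gamma^n_n$ be the associated variety of $J_q^n(n)$, and let $((a_{ij}),(b_{ij}))$ be a point in $\Gamma^n_n$. Then, for suitable choice of the representatives of the two projective points, either (1) there exist a non-zero $n\times1$ column $R$ and a $c\in\mathbb C^*$ such that $$(a_{ij})=(0,\dots,0,R,0,\dots,0,cR,0,\dots,0)$$ and $$(b_{ij})=(0,\dots,0,R',0,\dots,0,cq^2R',0,\dots,0),$$ where $R=(r_{1i},r_{2i},\dots,r_{ni})^t$ and $R'=(q^{1-i}r_{1i},q^{2-i}r_{2i},\dots,q^{n-i}r_{ni})^t$, with $i$ the index of the column in which $R$ stands; or (2) $(a_{ij})=\mathrm{diag}(A_1,A_2,\dots,A_n)$, where each $A_i$ is an $s_i\times1$ complex column for some positive integer $s_i$, and $(b_{ij})=(q^{i-j}a_{ij})$.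
   Context: $J_q^n(n)$ is the quadratic algebra over $\mathbb C$ with generators $N_{i,j}$, $1\le i,j\le n$, and relations $N_{i,j}N_{s,t}=q^{s-t-i+j-2}N_{s,t}N_{i,j}$ if $s\ge i$ and $t<j$; $N_{i,j}N_{s,t}=q^{s-i}N_{s,t}N_{i,j}$ if $s>i$ and $t=j$; $q^{t-j-1}N_{i,j}N_{s,t}=q^{s-i-1}N_{s,t}N_{i,j}+(q-q^{-1})N_{i,t}N_{s,j}$ if $s>i$ and $t>j$. For a quadratic algebra $T(V)/(R_0)$ with $R_0\subset V\otimes V$ and a basis $(x_k)$ of $V$, an element $f=\sum\alpha_{k,l}x_k\otimes x_l$ defines $f(p,p')=\sum\alpha_{k,l}x_k(p)x_l(p')$, and the associated variety is $\Gamma(R_0)=\{(p,p')\in\mathbb P(V^* )\times\mathbb P(V^* ): f(p,p')=0\text{ for all }f\in R_0\}$. Here $V$ has basis the $N_{i,j}$, and points of $\mathbb P(V^* )$ are represented by nonzero complex $n\times n$ matrices up to scalars, so $((a_{ij}),(b_{ij}))\in\Gamma^n_n$ means that the relations hold with each product $N_{i,j}N_{s,t}$ replaced by $a_{ij}b_{st}$. In (1) the matrices are written by their columns, and the two non-zero columns of $(b_{ij})$ stand in the same positions as those of $(a_{ij})$. In (2), $\mathrm{diag}(A_1,\dots,A_n)$ denotes the block-diagonal matrix with the (not necessarily square) blocks $A_1,\dots,A_n$.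
   Formalization: In (2) the heights s_i may be 0 (positive s_i would force a diagonal matrix and miss single-column points); in (1) the second non-zero column of (b_ij), at position j, is cq^2 times R twisted with its own index, (q^{k-j}r_k), not with the first index i. *)

theory Defs
  imports Complex_Main "HOL-Library.Poly_Mapping" "Jordan_Normal_Form.Matrix"
begin

text \<open>
  Matrix positions are counted from 0, as in \<^typ>\<open>complex mat\<close>. All exponents of \<open>q\<close> below
  depend on differences of indices only, so they agree with those for indices \<open>1, \<dots>, n\<close>.

  \<open>V\<close> is the space with basis \<open>N\<^sub>i\<^sub>j\<close>, the index \<open>(i, j)\<close> standing for \<open>N\<^sub>i\<^sub>j\<close>. An element of
  \<open>V \<otimes> V\<close> is given by its coefficients: the entry at \<open>(k, l)\<close> is the coefficient of
  \<open>N\<^sub>k \<otimes> N\<^sub>l\<close>.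
\<close>

type_synonym tensor2 = "((nat \<times> nat) \<times> (nat \<times> nat)) \<Rightarrow>\<^sub>0 complex"

definition tscale :: "complex \<Rightarrow> tensor2 \<Rightarrow> tensor2" where
  "tscale c f = Poly_Mapping.map (\<lambda>x. c * x) f"

lemma lookup_tscale: "Poly_Mapping.lookup (tscale c f) k = c * Poly_Mapping.lookup f k"
  unfolding tscale_def by transfer (simp add: when_def)

global_interpretation tensor2: vector_space tscale
  defines tensor2_span = tensor2.span
  by unfold_locales
    (auto intro!: poly_mapping_eqI simp: lookup_tscale lookup_add algebra_simps)

definition NN :: "nat \<times> nat \<Rightarrow> nat \<times> nat \<Rightarrow> tensor2" where
  "NN k l = Poly_Mapping.single (k, l) 1"

definition J_relators :: "complex \<Rightarrow> nat \<Rightarrow> tensor2 set" where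
  "J_relators q n =
     {NN (i,j) (s,t) - tscale (q powi (int s - int t - int i + int j - 2)) (NN (s,t) (i,j))
        | i j s t. i < n \<and> j < n \<and> s < n \<and> t < n \<and> s \<ge> i \<and> t < j}
   \<union> {NN (i,j) (s,t) - tscale (q powi (int s - int i)) (NN (s,t) (i,j))
        | i j s t. i < n \<and> j < n \<and> s < n \<and> t < n \<and> s > i \<and> t = j}
   \<union> {tscale (q powi (int t - int j - 1)) (NN (i,j) (s,t))
        - tscale (q powi (int s - int i - 1)) (NN (s,t) (i,j))
        - tscale (q - inverse q) (NN (i,t) (s,j))
        | i j s t. i < n \<and> j < n \<and> s < n \<and> t < n \<and> s > i \<and> t > j}"

text \<open>The subspace \<open>R\<^sub>0\<close> of \<open>V \<otimes> V\<close> for which \<open>J\<^sub>q\<^sup>n(n) = T(V)/(R\<^sub>0)\<close>.\<close>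

definition J_rel :: "complex \<Rightarrow> nat \<Rightarrow> tensor2 set" where
  "J_rel q n = tensor2_span (J_relators q n)"

text \<open>
  A linear form on \<open>V\<close> is represented by the matrix of its values on the basis \<open>N\<^sub>i\<^sub>j\<close>, and a point
  of \<open>\<P>(V\<^sup>*)\<close> is the set of all its non-zero representatives.
\<close>

definition proj_point :: "complex mat \<Rightarrow> complex mat set" where
  "proj_point A = {c \<cdot>\<^sub>m A | c. c \<noteq> 0}"

definition proj_space :: "nat \<Rightarrow> complex mat set set" where
  "proj_space n = proj_point ` (carrier_mat n n - {0\<^sub>m n n})"

definition tensor2_eval :: "tensor2 \<Rightarrow> complex mat \<Rightarrow> complex mat \<Rightarrow> complex" where
  "tensor2_eval f A B =
     (\<Sum>(k, l)\<in>Poly_Mapping.keys f. Poly_Mapping.lookup f (k, l) * A $$ k * B $$ l)"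

definition assoc_variety :: "nat \<Rightarrow> tensor2 set \<Rightarrow> (complex mat set \<times> complex mat set) set" where
  "assoc_variety n R0 =
     {(P, P') \<in> proj_space n \<times> proj_space n.
        \<forall>f\<in>R0. \<forall>A\<in>P. \<forall>B\<in>P'. tensor2_eval f A B = 0}"

definition Gamma :: "complex \<Rightarrow> nat \<Rightarrow> (complex mat set \<times> complex mat set) set" where
  "Gamma q n = assoc_variety n (J_rel q n)"

text \<open>The \<open>n \<times> n\<close> matrix with columns \<open>u\<close> at position \<open>i\<close>, \<open>v\<close> at position \<open>j\<close>, and 0 elsewhere.\<close>

definition two_col_mat :: "nat \<Rightarrow> nat \<Rightarrow> complex vec \<Rightarrow> nat \<Rightarrow> complex vec \<Rightarrow> complex mat" where
  "two_col_mat n i u j v =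
     mat n n (\<lambda>(k, l). if l = i then u $ k else if l = j then v $ k else 0)"

text \<open>
  The column \<open>R'\<close> belonging to a column \<open>R\<close> depends on the position \<open>i\<close> at which it stands. In a
  matrix with two non-zero columns, each of them is twisted with its own position: using the
  position of the first column for both would in general not give points of the associated variety.
\<close>

definition col_twist :: "complex \<Rightarrow> nat \<Rightarrow> complex vec \<Rightarrow> complex vec" where
  "col_twist q i R = vec (dim_vec R) (\<lambda>k. q powi (int k - int i) * R $ k)"

definition two_column_form :: "complex \<Rightarrow> nat \<Rightarrow> complex mat \<Rightarrow> complex mat \<Rightarrow> bool" where
  "two_column_form q n a b \<longleftrightarrow>
     (\<exists>i j R c. i < j \<and> j < n \<and> R \<in> carrier_vec n \<and> R \<noteq> 0\<^sub>v n \<and> c \<noteq> 0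
        \<and> a = two_col_mat n i R j (c \<cdot>\<^sub>v R)
        \<and> b = two_col_mat n i (col_twist q i R) j ((c * q\<^sup>2) \<cdot>\<^sub>v col_twist q j R))"

text \<open>
  The heights of the blocks may be 0, so that \<open>a\<close> may have zero columns: \<open>n\<close> columns of positive
  height that add up to \<open>n\<close> rows would all have height 1, which would leave only the diagonal
  matrices and miss, for example, the points with a single non-zero column.
\<close>

definition block_diagonal_form :: "complex \<Rightarrow> nat \<Rightarrow> complex mat \<Rightarrow> complex mat \<Rightarrow> bool" where
  "block_diagonal_form q n a b \<longleftrightarrow>
     (\<exists>As. length As = n \<and> (\<forall>A\<in>set As. \<exists>s. A \<in> carrier_mat s 1)
        \<and> a = diag_block_mat As
        \<and> b = mat n n (\<lambda>(i, j). q powi (int i - int j) * a $$ (i, j)))"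

end

theory Submission
  imports Defs
begin

text \<open>
  Let \<open>(a, b)\<close> represent a point of the variety. The powers of \<open>q\<close> in the relations are artefacts
  of the coordinates: after the substitution \<open>b\<^sub>i\<^sub>j = q\<^sup>i\<^sup>-\<^sup>j d\<^sub>i\<^sub>j\<close> only \<open>Q = q\<^sup>2\<close> survives, and the
  three families of relations become the assumptions \<open>same_col\<close>, \<open>anti_diag\<close> and \<open>main_diag\<close> of
  the locale \<open>twisted_point\<close>. These are conditions on pairs of columns.

  The relations inside one column say that the columns \<open>a\<^sub>j\<close> and \<open>d\<^sub>j\<close> are linearly dependent. The
  relations between two columns exclude that just one of the two vanishes, because this would force
  all of \<open>a\<close> or all of \<open>d\<close> to be zero; hence \<open>d\<^sub>j = g\<^sub>j a\<^sub>j\<close> with a non-zero scalar \<open>g\<^sub>j\<close>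
  (\<open>column_ratios\<close>).

  Substituting this, two non-zero columns \<open>j < t\<close> satisfy
  \<open>(Q g\<^sub>j - g\<^sub>t) a\<^sub>i\<^sub>t a\<^sub>s\<^sub>j = 0\<close> for \<open>i \<le> s\<close> and
  \<open>(g\<^sub>t - g\<^sub>j) a\<^sub>i\<^sub>j a\<^sub>s\<^sub>t = (Q - 1) g\<^sub>j a\<^sub>i\<^sub>t a\<^sub>s\<^sub>j\<close> for \<open>i < s\<close>.
  There are two ways out (\<open>column_pair\<close>): either the support of column \<open>j\<close> lies strictly above that
  of column \<open>t\<close>, and then \<open>g\<^sub>t = g\<^sub>j\<close>; or \<open>g\<^sub>t = Q g\<^sub>j\<close>, and then all the \<open>2 \<times> 2\<close> minors of the two
  columns vanish, so that they are proportional.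

  If a proportional pair occurs, a third non-zero column would have to stand in the same relation to
  both members of the pair, as these have the same support, and the ratios \<open>1\<close> and \<open>Q\<close> cannot be
  reconciled (\<open>no_third_column\<close>): the point has the form (1). Otherwise all \<open>g\<^sub>j\<close> of non-zero columns
  agree and can be scaled to 1, and the supports of the columns form a descending staircase, which is
  the same as being block diagonal with one-column blocks (\<open>staircase_imp_diag_block_mat\<close>): the
  point has the form (2).
\<close>

section \<open>The equations of the variety\<close>

lemma tensor2_eval_superset:
  assumes "finite S" "Poly_Mapping.keys f \<subseteq> S"
  shows "tensor2_eval f A B = (\<Sum>(k, l)\<in>S. Poly_Mapping.lookup f (k, l) * A $$ k * B $$ l)"
  unfolding tensor2_eval_def
  by (rule sum.mono_neutral_left) (use assms in \<open>auto simp: in_keys_iff\<close>)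

lemma tensor2_eval_NN: "tensor2_eval (NN k l) A B = A $$ k * B $$ l"
  by (subst tensor2_eval_superset[where S = "{(k, l)}"]) (auto simp: NN_def)

lemma tensor2_eval_tscale: "tensor2_eval (tscale c f) A B = c * tensor2_eval f A B"
  by (subst tensor2_eval_superset[where S = "Poly_Mapping.keys f"])
    (auto simp: in_keys_iff lookup_tscale tensor2_eval_def sum_distrib_left algebra_simps
      intro!: sum.cong)

lemma tensor2_eval_diff: "tensor2_eval (f - g) A B = tensor2_eval f A B - tensor2_eval g A B"
proof -
  let ?S = "Poly_Mapping.keys f \<union> Poly_Mapping.keys g"
  have "Poly_Mapping.keys (f - g) \<subseteq> ?S"
    by (auto simp: in_keys_iff lookup_minus)
  then show ?thesis
    using tensor2_eval_superset[of ?S f] tensor2_eval_superset[of ?S g]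
      tensor2_eval_superset[of ?S "f - g"]
    by (simp add: lookup_minus sum_subtractf[symmetric] case_prod_unfold algebra_simps)
qed

lemmas tensor2_eval_simps = tensor2_eval_NN tensor2_eval_tscale tensor2_eval_diff

text \<open>
  The relations of \<open>J\<^sub>q\<^sup>n(n)\<close>, evaluated at \<open>(a, b)\<close> with \<open>b\<^sub>i\<^sub>j = q\<^sup>i\<^sup>-\<^sup>j d\<^sub>i\<^sub>j\<close> and \<open>Q = q\<^sup>2\<close>. In
  \<open>anti_diag\<close> and \<open>main_diag\<close> the columns are called \<open>j < t\<close> and the rows \<open>i\<close>, \<open>s\<close>, with \<open>i\<close> not
  below \<open>s\<close>, so that for \<open>i < s\<close> both speak of the same \<open>2 \<times> 2\<close> submatrix.
\<close>

locale twisted_point =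
  fixes Q :: complex and n :: nat and a d :: "nat \<Rightarrow> nat \<Rightarrow> complex"
  assumes Q0: "Q \<noteq> 0" and Q1: "Q \<noteq> 1"
    and same_col: "\<lbrakk>i < n; s < n; j < n\<rbrakk> \<Longrightarrow> a i j * d s j = a s j * d i j"
    and anti_diag: "\<lbrakk>i \<le> s; s < n; j < t; t < n\<rbrakk> \<Longrightarrow> Q * (a i t * d s j) = a s j * d i t"
    and main_diag: "\<lbrakk>i < s; s < n; j < t; t < n\<rbrakk>
      \<Longrightarrow> a i j * d s t = a s t * d i j + (Q - 1) * (a i t * d s j)"
    and a_nonzero: "\<exists>i<n. \<exists>j<n. a i j \<noteq> 0"
    and d_nonzero: "\<exists>i<n. \<exists>j<n. d i j \<noteq> 0"

lemma twisted_point_of_Gamma: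
  assumes q: "q \<noteq> 0" "q\<^sup>2 \<noteq> 1"
    and pt: "(proj_point A, proj_point B) \<in> Gamma q n"
    and A: "A \<in> carrier_mat n n" "A \<noteq> 0\<^sub>m n n" and B: "B \<in> carrier_mat n n" "B \<noteq> 0\<^sub>m n n"
  shows "twisted_point (q\<^sup>2) n (\<lambda>i j. A $$ (i, j)) (\<lambda>i j. q powi (int j - int i) * B $$ (i, j))"
proof -
  have self: "M \<in> proj_point M" for M
    unfolding proj_point_def by (rule CollectI, rule exI[of _ 1]) auto
  have rel: "tensor2_eval f A B = 0" if "f \<in> J_relators q n" for f
  proof -
    have "f \<in> J_rel q n"
      unfolding J_rel_def using that by (rule tensor2.span_base)
    then show ?thesis
      using pt self[of A] self[of B] unfolding Gamma_def assoc_variety_def by blast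
  qed
  have r1: "A $$ (i, j) * B $$ (s, t)
      = q powi (int s - int t - int i + int j - 2) * (A $$ (s, t) * B $$ (i, j))"
    if "i \<le> s" "s < n" "t < j" "j < n" for i j s t
  proof -
    have "NN (i,j) (s,t) - tscale (q powi (int s - int t - int i + int j - 2)) (NN (s,t) (i,j))
        \<in> J_relators q n"
      using that unfolding J_relators_def by (intro UnI1) force
    from rel[OF this] show ?thesis by (simp add: tensor2_eval_simps)
  qed
  have r2: "A $$ (i, j) * B $$ (s, j) = q powi (int s - int i) * (A $$ (s, j) * B $$ (i, j))"
    if "i < s" "s < n" "j < n" for i j s
  proof -
    have "NN (i,j) (s,j) - tscale (q powi (int s - int i)) (NN (s,j) (i,j)) \<in> J_relators q n"
      using that unfolding J_relators_def by (intro UnI1 UnI2) force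
    from rel[OF this] show ?thesis by (simp add: tensor2_eval_simps)
  qed
  have r3: "q powi (int t - int j - 1) * (A $$ (i, j) * B $$ (s, t))
      = q powi (int s - int i - 1) * (A $$ (s, t) * B $$ (i, j))
        + (q - inverse q) * (A $$ (i, t) * B $$ (s, j))"
    if "i < s" "s < n" "j < t" "t < n" for i j s t
  proof -
    have "tscale (q powi (int t - int j - 1)) (NN (i,j) (s,t))
        - tscale (q powi (int s - int i - 1)) (NN (s,t) (i,j))
        - tscale (q - inverse q) (NN (i,t) (s,j)) \<in> J_relators q n"
      using that unfolding J_relators_def by (intro UnI2) force
    from rel[OF this] show ?thesis unfolding tensor2_eval_simps by (simp add: algebra_simps)
  qed
  have expand: "q powi (x + y) = q powi x * q powi y" "q powi (x - y) = q powi x / q powi y" for x y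
    using q(1) by (simp_all add: power_int_add power_int_diff)
  have col: "A $$ (i, j) * (q powi (int j - int s) * B $$ (s, j))
      = A $$ (s, j) * (q powi (int j - int i) * B $$ (i, j))"
    if "i < s" "s < n" "j < n" for i s j
    using r2[OF that] q(1) by (simp add: expand field_simps)
  have nonzero: "\<exists>i<n. \<exists>j<n. M $$ (i, j) \<noteq> 0" if "M \<in> carrier_mat n n" "M \<noteq> 0\<^sub>m n n" for M :: "complex mat"
  proof (rule ccontr)
    assume "\<not> ?thesis"
    then have "M = 0\<^sub>m n n" using that(1) by (intro eq_matI) auto
    with that(2) show False by simp
  qed
  show ?thesis
  proof
    fix i s j assume "i < n" "s < n" "j < n"
    then show "A $$ (i, j) * (q powi (int j - int s) * B $$ (s, j))
        = A $$ (s, j) * (q powi (int j - int i) * B $$ (i, j))"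
      using col[of i s j] col[of s i j] by (cases i s rule: linorder_cases) auto
  next
    fix i s j t assume "i \<le> s" "s < n" "j < t" "t < n"
    from r1[OF this] show "q\<^sup>2 * (A $$ (i, t) * (q powi (int j - int s) * B $$ (s, j)))
        = A $$ (s, j) * (q powi (int t - int i) * B $$ (i, t))"
      using q(1) by (simp add: expand field_simps)
  next
    fix i s j t assume "i < s" "s < n" "j < t" "t < n"
    from r3[OF this] show "A $$ (i, j) * (q powi (int t - int s) * B $$ (s, t))
        = A $$ (s, t) * (q powi (int j - int i) * B $$ (i, j))
          + (q\<^sup>2 - 1) * (A $$ (i, t) * (q powi (int j - int s) * B $$ (s, j)))"
      using q(1) by (simp add: expand field_simps power2_eq_square)
  next
    show "\<exists>i<n. \<exists>j<n. q powi (int j - int i) * B $$ (i, j) \<noteq> 0"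
      using nonzero[OF B] q(1) by simp
  qed (use q nonzero[OF A] in auto)
qed

section \<open>The columns of a point\<close>

context twisted_point
begin

text \<open>
  If column \<open>j\<close> of \<open>a\<close> vanishes and \<open>d\<^sub>k\<^sub>j \<noteq> 0\<close>, then in each relation that contains \<open>d\<^sub>k\<^sub>j\<close> only one
  term remains, or all but one are already known to vanish. Together these relations reach every
  entry of the other columns of \<open>a\<close>, contradicting \<open>a \<noteq> 0\<close>.
\<close>

lemma a_zero_col:
  assumes "j < n" and zero: "\<And>i. i < n \<Longrightarrow> a i j = 0" and "k < n"
  shows "d k j = 0"
proof (rule ccontr)
  assume kj: "d k j \<noteq> 0"
  have right: "a i t = 0" if "i < n" "j < t" "t < n" for i t
  proof -
    \<comment> \<open>Row \<open>k\<close> itself comes from \<open>anti_diag\<close>, and it removes the mixed term of \<open>main_diag\<close> for the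
      rows below \<open>k\<close>.\<close>
    have upto: "a i t = 0" if "i \<le> k" for i
      using anti_diag[of i k j t] zero kj Q0 that \<open>j < n\<close> \<open>k < n\<close> \<open>j < t\<close> \<open>t < n\<close> by auto
    show ?thesis
      using upto[of i] upto[of k] main_diag[of k i j t] zero kj that \<open>k < n\<close>
      by (cases "i \<le> k") auto
  qed
  have left: "a i t = 0" if "i < n" "t < j" for i t
    using anti_diag[of k i t j] main_diag[of i k t j] zero kj that \<open>j < n\<close> \<open>k < n\<close>
    by (cases "k \<le> i") auto
  have "a i t = 0" if "i < n" "t < n" for i t
    using right left zero that by (cases t j rule: linorder_cases) auto
  then show False using a_nonzero by auto
qed

text \<open>
  The same argument with \<open>a\<close> and \<open>d\<close> exchanged. As \<open>main_diag\<close> is not symmetric in \<open>a\<close> and \<open>d\<close>, it is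
  now on the left of column \<open>j\<close> that row \<open>k\<close> has to be treated first.
\<close>

lemma d_zero_col:
  assumes "j < n" and zero: "\<And>i. i < n \<Longrightarrow> d i j = 0" and "k < n"
  shows "a k j = 0"
proof (rule ccontr)
  assume kj: "a k j \<noteq> 0"
  have right: "d i t = 0" if "i < n" "j < t" "t < n" for i t
    using anti_diag[of i k j t] main_diag[of k i j t] zero kj that \<open>j < n\<close> \<open>k < n\<close>
    by (cases "i \<le> k") auto
  have left: "d i t = 0" if "i < n" "t < j" for i t
  proof -
    have below: "d s t = 0" if "k \<le> s" "s < n" for s
      using anti_diag[of k s t j] zero kj Q0 that \<open>j < n\<close> \<open>t < j\<close> by auto
    show ?thesis
      using below[of i] below[of k] main_diag[of i k t j] zero kj that \<open>k < n\<close> \<open>j < n\<close>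
      by (cases "k \<le> i") auto
  qed
  have "d i t = 0" if "i < n" "t < n" for i t
    using right left zero that by (cases t j rule: linorder_cases) auto
  then show False using d_nonzero by auto
qed

lemma column_ratios:
  obtains g where "\<And>j. j < n \<Longrightarrow> g j \<noteq> 0" "\<And>i j. \<lbrakk>i < n; j < n\<rbrakk> \<Longrightarrow> d i j = g j * a i j"
proof -
  have "\<exists>g. g \<noteq> 0 \<and> (\<forall>i<n. d i j = g * a i j)" if j: "j < n" for j
  proof (cases "\<exists>k<n. a k j \<noteq> 0")
    case True
    then obtain k where k: "k < n" "a k j \<noteq> 0" by blast
    \<comment> \<open>The vanishing minors of \<open>(a\<^sub>j, d\<^sub>j)\<close> give a ratio, and \<open>d_zero_col\<close> keeps it from being 0.\<close>
    have eq: "d i j = d k j / a k j * a i j" if "i < n" for i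
      using same_col[of i k j] that k j by (simp add: field_simps)
    have "d k j \<noteq> 0"
    proof
      assume "d k j = 0"
      then have "d i j = 0" if "i < n" for i using eq[OF that] by simp
      then show False using d_zero_col[OF j _ k(1)] k(2) by blast
    qed
    then have "d k j / a k j \<noteq> 0" using k(2) by simp
    with eq show ?thesis by blast
  next
    case False
    \<comment> \<open>Both columns are zero and any non-zero ratio will do.\<close>
    then show ?thesis using a_zero_col[OF j] by (intro exI[of _ 1]) auto
  qed
  then show ?thesis using that by metis
qed

end

locale twisted_point_ratios = twisted_point +
  fixes g :: "nat \<Rightarrow> complex"
  assumes g_nonzero: "j < n \<Longrightarrow> g j \<noteq> 0"
    and d_eq: "\<lbrakk>i < n; j < n\<rbrakk> \<Longrightarrow> d i j = g j * a i j"
begin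

definition above :: "nat \<Rightarrow> nat \<Rightarrow> bool" where
  "above j t \<longleftrightarrow> (\<forall>s<n. \<forall>i<n. a s j \<noteq> 0 \<longrightarrow> a i t \<noteq> 0 \<longrightarrow> s < i)"

definition parallel :: "nat \<Rightarrow> nat \<Rightarrow> bool" where
  "parallel j t \<longleftrightarrow> (\<exists>c. c \<noteq> 0 \<and> (\<forall>i<n. a i t = c * a i j))"

definition nonzero_col :: "nat \<Rightarrow> bool" where
  "nonzero_col j \<longleftrightarrow> j < n \<and> (\<exists>i<n. a i j \<noteq> 0)"

text \<open>
  If the support of column \<open>j\<close> is not strictly above that of column \<open>t\<close>, some product \<open>a\<^sub>i\<^sub>t a\<^sub>s\<^sub>j\<close> with
  \<open>i \<le> s\<close> is non-zero, and \<open>anti_diag\<close> forces \<open>g\<^sub>t = Q g\<^sub>j\<close>. The other relation then carries the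
  factor \<open>(Q - 1) g\<^sub>j\<close> on both sides and turns into the vanishing of all minors. In the strictly
  separated case the mixed term drops out, which leaves \<open>g\<^sub>t = g\<^sub>j\<close>.
\<close>

lemma column_pair:
  assumes "j < t" and nz: "nonzero_col j" "nonzero_col t"
  shows "above j t \<and> g t = g j \<or> parallel j t \<and> g t = Q * g j"
proof -
  have jt: "j < n" "t < n" using nz by (auto simp: nonzero_col_def)
  obtain k where k: "k < n" "a k j \<noteq> 0" using nz by (auto simp: nonzero_col_def)
  obtain l where l: "l < n" "a l t \<noteq> 0" using nz by (auto simp: nonzero_col_def)
  have anti: "Q * g j * (a i t * a s j) = g t * (a i t * a s j)" if "i \<le> s" "s < n" for i s
    using anti_diag[OF that \<open>j < t\<close> jt(2)] that jt d_eq[of s j] d_eq[of i t] by simp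
  have diag: "(g t - g j) * (a i j * a s t) = (Q - 1) * g j * (a i t * a s j)"
    if "i < s" "s < n" for i s
    using main_diag[OF that \<open>j < t\<close> jt(2)] that jt d_eq[of s j] d_eq[of s t] d_eq[of i j]
    by (simp add: algebra_simps)
  show ?thesis
  proof (cases "above j t")
    case True
    then have "k < l" "a k t = 0" using k l by (auto simp: above_def)
    with diag[of k l] k l have "g t = g j" by auto
    with True show ?thesis by simp
  next
    case False
    then obtain s i where si: "s < n" "i \<le> s" "a s j \<noteq> 0" "a i t \<noteq> 0"
      by (auto simp: above_def not_less)
    have gt: "g t = Q * g j" using anti[OF si(2,1)] si by simp
    have lt: "a i j * a s t = a i t * a s j" if "i < s" "s < n" for i s
    proof -
      have "(Q - 1) * g j * (a i j * a s t) = (Q - 1) * g j * (a i t * a s j)"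
        using diag[OF that] by (simp add: gt algebra_simps)
      moreover have "(Q - 1) * g j \<noteq> 0" using Q1 g_nonzero[OF jt(1)] by simp
      ultimately show ?thesis by (metis mult_left_cancel)
    qed
    have minors: "a i j * a s t = a i t * a s j" if "i < n" "s < n" for i s
      using lt[of i s] lt[of s i] that
      by (cases i s rule: linorder_cases) (auto simp: mult.commute)
    let ?c = "a k t / a k j"
    have c: "a i t = ?c * a i j" if "i < n" for i
      using minors[OF that k(1)] k(2) by (simp add: field_simps)
    moreover have "?c \<noteq> 0"
      using c[OF l(1)] l(2) by auto
    ultimately have "parallel j t" unfolding parallel_def by blast
    with gt show ?thesis by simp
  qed
qed

lemma parallel_same_support: "parallel j t \<Longrightarrow> i < n \<Longrightarrow> a i j \<noteq> 0 \<longleftrightarrow> a i t \<noteq> 0"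
  by (auto simp: parallel_def)

lemma above_irrefl: "\<lbrakk>nonzero_col j; \<And>i. i < n \<Longrightarrow> a i j \<noteq> 0 \<longleftrightarrow> a i t \<noteq> 0\<rbrakk> \<Longrightarrow> \<not> above j t"
  by (auto simp: above_def nonzero_col_def)

text \<open>
  Columns \<open>j\<close> and \<open>t\<close> have the same support, so an outer column \<open>u\<close> is in the same alternative of
  \<open>column_pair\<close> with both of them, which would give \<open>g\<^sub>j = g\<^sub>t\<close>. If \<open>u\<close> stands between them, the strict
  alternative is impossible on either side, and two proportional pairs in a row would give
  \<open>g\<^sub>t = Q\<^sup>2 g\<^sub>j\<close> in place of \<open>g\<^sub>t = Q g\<^sub>j\<close>.
\<close>

lemma no_third_column:
  assumes jt: "j < t" "nonzero_col j" "nonzero_col t" "parallel j t" "g t = Q * g j"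
    and u: "nonzero_col u"
  shows "u = j \<or> u = t"
proof (rule ccontr)
  assume neq: "\<not> ?thesis"
  note supp = parallel_same_support[OF jt(4)]
  have gj: "g j \<noteq> 0" "g u \<noteq> 0" using g_nonzero jt(2) u by (auto simp: nonzero_col_def)
  consider "u < j" | "j < u" "u < t" | "t < u" using neq by linarith
  then show False
  proof cases
    case 1
    have "above u j \<longleftrightarrow> above u t" using supp by (auto simp: above_def)
    moreover have "\<not> above u x" if "parallel u x" for x
      using above_irrefl[OF u] parallel_same_support[OF that] by blast
    ultimately have "g j = g t"
      using column_pair[of u j] column_pair[of u t] 1 jt u by fastforce
    then show False using jt(5) gj Q1 by auto
  next
    case 2
    have ju: "above j u \<and> g u = g j \<or> parallel j u \<and> g u = Q * g j"
      using column_pair 2 jt u by blast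
    have ut: "above u t \<and> g t = g u \<or> parallel u t \<and> g t = Q * g u"
      using column_pair 2 jt u by blast
    show False
    proof (cases "above j u")
      case True
      obtain k l where kl: "k < n" "a k j \<noteq> 0" "l < n" "a l u \<noteq> 0"
        using jt(2) u by (auto simp: nonzero_col_def)
      have "k < l" "a k u = 0" using True kl by (auto simp: above_def)
      have kt: "a k t \<noteq> 0" using supp kl by blast
      have "\<not> above u t"
        using kl kt \<open>k < l\<close> unfolding above_def by (meson less_asym)
      moreover have "\<not> parallel u t"
        using parallel_same_support[of u t k] kl(1) kt \<open>a k u = 0\<close> by blast
      ultimately show False using ut by blast
    next
      case False
      then have *: "parallel j u" "g u = Q * g j" using ju by auto
      then have "\<not> above u t"
        using above_irrefl[OF u, of t] supp parallel_same_support[of j u] by blast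
      then have "g t = Q * g u" using ut by blast
      then show False using * jt(5) gj Q0 Q1 by auto
    qed
  next
    case 3
    have "above j u \<longleftrightarrow> above t u" using supp by (auto simp: above_def)
    moreover have "\<not> above x u" if "parallel x u" "nonzero_col x" for x
      using above_irrefl[OF that(2)] parallel_same_support[OF that(1)] by blast
    ultimately have "g j = g t"
      using column_pair[of j u] column_pair[of t u] 3 jt u Q0 by fastforce
    then show False using jt(5) gj Q1 by auto
  qed
qed

end

section \<open>Staircase supports and block-diagonal matrices\<close>

text \<open>
  The rows of block \<open>j\<close> are \<open>p j, \<dots>, p (j + 1) - 1\<close>. Since \<^const>\<open>diag_block_mat\<close> recurses from the
  front of the list, the induction is about the lower right corner that starts with block \<open>m\<close>.
\<close>

lemma diag_block_mat_columns:
  fixes a :: "'a :: zero mat" and p :: "nat \<Rightarrow> nat"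
  assumes p: "mono p" and supp: "\<And>k j. \<lbrakk>k < p n; j < n; a $$ (k, j) \<noteq> 0\<rbrakk> \<Longrightarrow> p j \<le> k \<and> k < p (Suc j)"
    and "m \<le> n"
  shows "diag_block_mat (map (\<lambda>j. mat (p (Suc j) - p j) 1 (\<lambda>(k, _). a $$ (p j + k, j))) [m..<n])
    = mat (p n - p m) (n - m) (\<lambda>(k, j). a $$ (p m + k, m + j))"
  using \<open>m \<le> n\<close>
proof (induction m rule: inc_induct)
  case base
  then show ?case by (auto intro!: eq_matI)
next
  case (step m)
  have le: "p m \<le> p (Suc m)" "p (Suc m) \<le> p n"
    using p step.hyps by (auto intro: monoD)
  have above0: "a $$ (p m + k, Suc m + j) = 0"
    if "k < p (Suc m) - p m" "j < n - Suc m" for k j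
  proof (rule ccontr)
    assume "a $$ (p m + k, Suc m + j) \<noteq> 0"
    moreover have "p (Suc m) \<le> p (Suc m + j)" using p by (auto intro: monoD)
    moreover have "p m + k < p (Suc m)" "p m + k < p n" "Suc m + j < n"
      using that le by linarith+
    ultimately show False using supp[of "p m + k" "Suc m + j"] by linarith
  qed
  have below0: "a $$ (p m + k, m) = 0" if "p (Suc m) \<le> p m + k" "k < p n - p m" for k
  proof (rule ccontr)
    assume "a $$ (p m + k, m) \<noteq> 0"
    moreover have "p m + k < p n" using that by linarith
    ultimately show False using supp[of "p m + k" m] that(1) step.hyps by linarith
  qed
  have upt: "[m..<n] = m # [Suc m..<n]" using step.hyps by (simp add: upt_conv_Cons)
  show ?case
    unfolding upt list.map diag_block_mat.simps step.IH Let_def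
  proof (rule eq_matI, goal_cases)
    case (1 k j)
    then have kj: "k < p n - p m" "j < n - m" by auto
    show ?case
    proof (cases j)
      case 0
      then show ?thesis using kj le below0[of k] step.hyps by (auto simp: four_block_mat_def Let_def)
    next
      case (Suc j')
      then show ?thesis using kj le above0[of k j'] step.hyps
        by (auto simp: four_block_mat_def Let_def add.commute)
    qed
  qed (use le step.hyps in auto)
qed

text \<open>
  The cut \<open>p j\<close> is placed just below the last non-zero row of the columns before \<open>j\<close>; the staircase
  condition says that column \<open>j\<close> lives below it. The last cut has to be \<open>n\<close> for the blocks to
  exhaust all rows, so zero rows at the bottom are given to the last block, and a zero column before
  the last one becomes a block without rows.
\<close>

lemma staircase_imp_diag_block_mat:
  fixes a :: "'a :: zero mat"
  assumes a: "a \<in> carrier_mat n n"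
    and stair: "\<And>j t s i. \<lbrakk>j < t; t < n; s < n; i < n; a $$ (s, j) \<noteq> 0; a $$ (i, t) \<noteq> 0\<rbrakk> \<Longrightarrow> s < i"
  shows "\<exists>As. length As = n \<and> (\<forall>A\<in>set As. \<exists>s. A \<in> carrier_mat s 1) \<and> a = diag_block_mat As"
proof -
  define S where "S j = {Suc k | k l. k < n \<and> l < j \<and> a $$ (k, l) \<noteq> 0}" for j
  define p where "p j = (if j < n then Max (insert 0 (S j)) else n)" for j
  have fin: "finite (S j)" for j
    by (rule finite_subset[of _ "Suc ` {..<n}"]) (auto simp: S_def)
  have p_le: "p j \<le> n" for j
    using fin[of j] by (auto simp: p_def S_def)
  have mono: "mono p"
  proof (rule monoI)
    fix x y :: nat assume "x \<le> y"
    show "p x \<le> p y"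
    proof (cases "y < n")
      case True
      have "S x \<subseteq> S y" using \<open>x \<le> y\<close> by (force simp: S_def)
      then show ?thesis using True \<open>x \<le> y\<close> fin by (auto simp: p_def intro!: Max_mono)
    next
      case False
      then show ?thesis using p_le[of x] by (simp add: p_def)
    qed
  qed
  have pn: "p n = n" by (simp add: p_def)
  have p0: "p 0 = 0" by (simp add: p_def S_def)
  have supp: "p j \<le> k \<and> k < p (Suc j)" if "k < p n" "j < n" "a $$ (k, j) \<noteq> 0" for k j
  proof
    have "k < n" using that pn by simp
    have "x \<le> k" if "x \<in> S j" for x
      using that stair[OF _ \<open>j < n\<close> _ \<open>k < n\<close> _ \<open>a $$ (k, j) \<noteq> 0\<close>] by (force simp: S_def)
    then show "p j \<le> k" using fin \<open>j < n\<close> by (simp add: p_def)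
    have "Suc k \<in> S (Suc j)" using that \<open>k < n\<close> by (auto simp: S_def)
    then have "Suc k \<le> Max (insert 0 (S (Suc j)))" using fin by (intro Max_ge) auto
    then show "k < p (Suc j)" using \<open>k < n\<close> by (simp add: p_def)
  qed
  let ?As = "map (\<lambda>j. mat (p (Suc j) - p j) 1 (\<lambda>(k, _). a $$ (p j + k, j))) [0..<n]"
  have "diag_block_mat ?As = a"
    using diag_block_mat_columns[where a = a and p = p and n = n and m = 0, OF mono supp] a
    by (auto simp: p0 pn intro!: eq_matI)
  then show ?thesis by (intro exI[of _ ?As]) (auto intro: mat_carrier)
qed

section \<open>The classification\<close>

theorem theorem8p7:
  fixes q :: complex and n :: nat and P P' :: "complex mat set"
  assumes "q \<noteq> 0" and "q\<^sup>2 \<noteq> 1"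
    and "(P, P') \<in> Gamma q n"
  shows "\<exists>a\<in>P. \<exists>b\<in>P'. two_column_form q n a b \<or> block_diagonal_form q n a b"
proof -
  have "P \<in> proj_space n" "P' \<in> proj_space n"
    using assms(3) by (auto simp: Gamma_def assoc_variety_def)
  then obtain A B where A: "A \<in> carrier_mat n n" "A \<noteq> 0\<^sub>m n n" "P = proj_point A"
    and B: "B \<in> carrier_mat n n" "B \<noteq> 0\<^sub>m n n" "P' = proj_point B"
    by (auto simp: proj_space_def)
  let ?a = "\<lambda>i j. A $$ (i, j)" and ?d = "\<lambda>i j. q powi (int j - int i) * B $$ (i, j)"
  interpret twisted_point "q\<^sup>2" n ?a ?d
    using twisted_point_of_Gamma[OF assms(1,2) assms(3)[unfolded A(3) B(3)] A(1,2) B(1,2)] .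
  obtain g where g: "\<And>j. j < n \<Longrightarrow> g j \<noteq> 0"
    "\<And>i j. \<lbrakk>i < n; j < n\<rbrakk> \<Longrightarrow> ?d i j = g j * ?a i j"
    using column_ratios by blast
  interpret twisted_point_ratios "q\<^sup>2" n ?a ?d g
    by unfold_locales (use g in auto)
  have B_eq: "B $$ (i, j) = q powi (int i - int j) * (g j * A $$ (i, j))" if "i < n" "j < n" for i j
  proof -
    have "q powi (int i - int j) * ?d i j = B $$ (i, j)"
      using assms(1) by (simp add: power_int_diff)
    then show ?thesis using g(2)[OF that] by simp
  qed
  have AP: "A \<in> P"
    unfolding A(3) proj_point_def by (rule CollectI, rule exI[of _ 1]) auto
  have BP: "inverse c \<cdot>\<^sub>m B \<in> P'" if "c \<noteq> 0" for c
    unfolding B(3) proj_point_def using that by auto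
  show ?thesis
  proof (cases "\<exists>j t. j < t \<and> nonzero_col j \<and> nonzero_col t \<and> \<not> above j t")
    case True
    then obtain j t where jt: "j < t" "nonzero_col j" "nonzero_col t" "parallel j t" "g t = q\<^sup>2 * g j"
      using column_pair by blast
    then have less: "j < n" "t < n" by (auto simp: nonzero_col_def)
    from jt(4) obtain c where c: "c \<noteq> 0" "\<And>i. i < n \<Longrightarrow> A $$ (i, t) = c * A $$ (i, j)"
      by (auto simp: parallel_def)
    have zero: "A $$ (i, u) = 0" if "i < n" "u < n" "u \<noteq> j" "u \<noteq> t" for i u
      using no_third_column[OF jt, of u] that by (auto simp: nonzero_col_def)
    let ?R = "vec n (\<lambda>i. A $$ (i, j))"
    have R0: "?R \<noteq> 0\<^sub>v n"
    proof
      assume "?R = 0\<^sub>v n"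
      then have "?R $ i = 0" if "i < n" for i using that by simp
      then show False using jt(2) by (auto simp: nonzero_col_def)
    qed
    have "A = two_col_mat n j ?R t (c \<cdot>\<^sub>v ?R)"
      using A(1) zero c jt(1) by (auto simp: two_col_mat_def intro!: eq_matI)
    \<comment> \<open>Scaling by \<open>1 / g\<^sub>j\<close> makes column \<open>j\<close> the twist of \<open>R\<close>; column \<open>t\<close> keeps the factor
      \<open>g\<^sub>t / g\<^sub>j = q\<^sup>2\<close>.\<close>
    moreover have "inverse (g j) \<cdot>\<^sub>m B
        = two_col_mat n j (col_twist q j ?R) t ((c * q\<^sup>2) \<cdot>\<^sub>v col_twist q t ?R)"
      using B(1) zero c jt(1,5) B_eq g(1)[OF less(1)]
      by (auto simp: two_col_mat_def col_twist_def intro!: eq_matI)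
    ultimately have "two_column_form q n A (inverse (g j) \<cdot>\<^sub>m B)"
      unfolding two_column_form_def using jt(1) less(2) R0 c(1)
      by (intro exI[of _ j] exI[of _ t] exI[of _ ?R] exI[of _ c]) simp
    then show ?thesis using AP BP g(1)[OF less(1)] by blast
  next
    case False
    obtain k where k: "nonzero_col k"
      using a_nonzero by (auto simp: nonzero_col_def)
    then have gk: "g k \<noteq> 0" using g(1) by (simp add: nonzero_col_def)
    have same_ratio: "g t = g j" if "j < t" "nonzero_col j" "nonzero_col t" for j t
    proof -
      have "above j t" using False that by blast
      then have "\<not> parallel j t" using above_irrefl[OF that(2)] parallel_same_support by blast
      then show ?thesis using column_pair[OF that] by blast
    qed
    have gu: "g u = g k" if "nonzero_col u" for u
      using same_ratio[of u k] same_ratio[of k u] that k by (cases u k rule: linorder_cases) auto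
    have stair: "s < i" if "j < t" "t < n" "s < n" "i < n" "A $$ (s, j) \<noteq> 0" "A $$ (i, t) \<noteq> 0" for j t s i
    proof -
      have "nonzero_col j" "nonzero_col t" using that by (auto simp: nonzero_col_def)
      then have "above j t" using False that(1) by blast
      then show ?thesis using that by (auto simp: above_def)
    qed
    have "\<exists>As. length As = n \<and> (\<forall>M\<in>set As. \<exists>s. M \<in> carrier_mat s 1) \<and> A = diag_block_mat As"
      by (rule staircase_imp_diag_block_mat[OF A(1)]) (rule stair)
    then obtain As
      where As: "length As = n" "\<forall>M\<in>set As. \<exists>s. M \<in> carrier_mat s 1" "A = diag_block_mat As"
      by blast
    have "inverse (g k) * B $$ (i, j) = q powi (int i - int j) * A $$ (i, j)" if "i < n" "j < n" for i j
    proof (cases "A $$ (i, j) = 0")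
      case False
      then have "g j = g k" using gu[of j] that by (auto simp: nonzero_col_def)
      then show ?thesis using B_eq[OF that] gk by simp
    qed (simp add: B_eq[OF that])
    then have "inverse (g k) \<cdot>\<^sub>m B = mat n n (\<lambda>(i, j). q powi (int i - int j) * A $$ (i, j))"
      using B(1) by (auto intro!: eq_matI)
    with As have "block_diagonal_form q n A (inverse (g k) \<cdot>\<^sub>m B)"
      unfolding block_diagonal_form_def by blast
    then show ?thesis using AP BP[OF gk] by blast
  qed
qed

end
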